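(* For sequences $\{P_n\}_{n\in\mathbb{N}_0}$ and $\{\tilde P_n\}_{n\in\mathbb{N}_0}$ of $N\times N$ matrix-valued orthogonal polynomials (with respect to weight matrices $W$ and $\tilde W$ of size $N$ on $(x_0,x_1)$), write $P_n\sim\tilde P_n$ if and only if $\{\tilde P_n\}$ is a Darboux transformation of $\{P_n\}$. Then $\sim$ is an equivalence relation on the set of sequences of $N\times N$ matrix-valued orthogonal polynomials.
   Context: Fix a possibly infinite interval $(x_0,x_1)$ of the real line. A weight matrix of size $N$ is a complex $N\times N$ matrix-valued smooth function $W$ on $(x_0,x_1)$ that is positive definite almost everywhere and has finite moments of all orders. For $P,Q\in\operatorname{Mat}_N(\mathbb{C}[x])$ put $\langle P,Q\rangle_W=\int_{x_0}^{x_1}P(x)W(x)Q(x)^*\,dx$, where $*$ is the Hermitian conjugate. A sequence of matrix-valued orthogonal polynomials with respect to $W$ is a sequence $\{P_n\}_{n\in\mathbb{N}_0}$ in $\operatorname{Mat}_N(\mathbb{C}[x])$, $\mathbb{N}_0=\{0,1,\dots\}$, with $P_n$ of degree $n$ with nonsingular leading coefficient and $\langle P_n,P_m\rangle_W=0$ for $n\ne m$. Differential operators $D=\sum_{i=0}^s\partial^iF_i(x)$, $\partial=\frac{d}{dx}$, act on the right: $(P\cdot D)(x)=\sum_{i=0}^s\frac{d^iP}{dx^i}(x)F_i(x)$, and $P\cdot(DE)=(P\cdot D)\cdot E$. $\operatorname{Mat}_N(\Omega[x])$ is the algebra of such operators with $F_i\in\operatorname{Mat}_N(\mathbb{C}[x])$.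 $\mathcal{D}(W)$ is the set of $D\in\operatorname{Mat}_N(\Omega[x])$ such that, for every $n\in\mathbb{N}_0$, $P_n\cdot D=\Lambda_n(D)P_n$ for some $\Lambda_n(D)\in\operatorname{Mat}_N(\mathbb{C})$ (this does not depend on the chosen orthogonal sequence $\{P_n\}$ for $W$). An operator $E\in\operatorname{Mat}_N(\Omega[x])$ is degree-preserving if, for all but finitely many $n\in\mathbb{N}_0$, for any (matrix) polynomial $f$ of degree $n$ the function $f\cdot E$ is again a polynomial of degree $n$. The sequence $\{\tilde P_n\}$ (orthogonal with respect to $\tilde W$) is a Darboux transformation of $\{P_n\}$ (orthogonal with respect to $W$) if there is $D\in\mathcal{D}(W)$ that can be factorized as $D=\mathcal{V}\mathcal{N}$ with degree-preserving $\mathcal{V},\mathcal{N}\in\operatorname{Mat}_N(\Omega[x])$ such that $P_n\cdot\mathcal{V}=A_n\tilde P_n$ for all $n\in\mathbb{N}_0$, for some $A_n\in\operatorname{Mat}_N(\mathbb{C})$. For $D=\sum_j\partial^jF_j$ let $D^*=\sum_jF_j(x)^*(-1)^j\partial^j$ be the formal adjoint; thus $Q\cdot(WD^*W^{-1})=\sum_j(-1)^j\frac{d^j}{dx^j}(QWF_j^* )W^{-1}$. Standing assumption on weights: all weight matrices considered (including direct sums, i.e. block diagonal matrices, of the weights considered) are "good enough" in the following sense, written for a weight $W$ of size $N$: if $D\in\operatorname{Mat}_N(\Omega[x])$ and $A\in\operatorname{Mat}_N(\mathbb{C}[x])$ satisfy $\int_{x_0}^{x_1}PAW\,dx=\int_{x_0}^{x_1}P\,(W\cdot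 D)\,dx$ for all $P\in\operatorname{Mat}_N(\mathbb{C}[x])$, then $AW=W\cdot D$. In particular, whenever $D,\tilde D\in\operatorname{Mat}_N(\Omega[x])$ satisfy $\langle P\cdot D,Q\rangle_W=\langle P,Q\cdot\tilde D\rangle_W$ for all $P,Q\in\operatorname{Mat}_N(\mathbb{C}[x])$, one has $\tilde D=WD^*W^{-1}$. *)

theory Defs
  imports "HOL-Analysis.Analysis" "HOL-Computational_Algebra.Polynomial"
begin

section \<open>Matrix polynomials\<close>

text \<open>The matrix size \<open>N\<close> is the cardinality of the finite index type. Both constant matrices and
  matrices of polynomials are multiplied with \<open>**\<close>; the operation \<open>*\<close> on these types is entrywise
  and is never used.\<close>

type_synonym 'n cmat = "complex^'n^'n"
type_synonym 'n pmat = "complex poly^'n^'n"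

definition herm :: "'n::finite cmat \<Rightarrow> 'n cmat"
  where "herm M = (\<chi> i j. cnj (M $ j $ i))"

definition posdef :: "'n::finite cmat \<Rightarrow> bool"
  where "posdef M \<longleftrightarrow> herm M = M \<and>
    (\<forall>v::complex^'n. v \<noteq> 0 \<longrightarrow> 0 < Re (\<Sum>i\<in>UNIV. \<Sum>j\<in>UNIV. cnj (v $ i) * M $ i $ j * v $ j))"

definition pm_const :: "'n::finite cmat \<Rightarrow> 'n pmat"
  where "pm_const A = (\<chi> i j. [:A $ i $ j:])"

definition pm_eval :: "'n::finite pmat \<Rightarrow> real \<Rightarrow> 'n cmat"
  where "pm_eval P x = (\<chi> i j. poly (P $ i $ j) (of_real x))"

definition pm_coeff :: "'n::finite pmat \<Rightarrow> nat \<Rightarrow> 'n cmat"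
  where "pm_coeff P k = (\<chi> i j. coeff (P $ i $ j) k)"

definition pm_deriv :: "'n::finite pmat \<Rightarrow> 'n pmat"
  where "pm_deriv P = (\<chi> i j. pderiv (P $ i $ j))"

text \<open>The leading coefficient only has to be a nonzero matrix, possibly a singular one. The zero
  polynomial has no degree.\<close>

definition has_degree :: "'n::finite pmat \<Rightarrow> nat \<Rightarrow> bool"
  where "has_degree P n \<longleftrightarrow> pm_coeff P n \<noteq> 0 \<and> (\<forall>k>n. pm_coeff P k = 0)"


section \<open>Differential operators acting on the right\<close>

text \<open>The operator \<open>\<Sum>\<^sub>i \<partial>\<^sup>i F\<^sub>i\<close> is represented by the (finitely supported) sequence of its
  coefficients \<open>F\<^sub>i\<close>, that is, as a formal polynomial in \<open>\<partial>\<close> with coefficients in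
  \<open>'n pmat\<close>. The library multiplication of such polynomials is not the composition of operators,
  which is \<open>dop_mult\<close> below.\<close>

type_synonym 'n dop = "'n pmat poly"

definition dop_act :: "'n::finite pmat \<Rightarrow> 'n dop \<Rightarrow> 'n pmat"
  where "dop_act P D = (\<Sum>i\<le>degree D. (pm_deriv ^^ i) P ** coeff D i)"

text \<open>The product is given by the Leibniz rule
  \<open>F \<partial>\<^sup>j = \<Sum>\<^sub>k (j choose k) \<partial>\<^sup>k F\<^sup>(\<^sup>j\<^sup>-\<^sup>k\<^sup>)\<close>, valid for operators acting on the right;
  see lemma \<open>dop_act_mult\<close>.\<close>

definition dop_mult :: "'n::finite dop \<Rightarrow> 'n dop \<Rightarrow> 'n dop"
  where "dop_mult D E = (\<Sum>i\<le>degree D. \<Sum>j\<le>degree E. \<Sum>k\<le>j.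
     monom (mat (of_nat (j choose k)) ** ((pm_deriv ^^ (j - k)) (coeff D i) ** coeff E j)) (i + k))"

definition nth_deriv :: "nat \<Rightarrow> (real \<Rightarrow> 'n::finite cmat) \<Rightarrow> real \<Rightarrow> 'n cmat"
  where "nth_deriv k = (\<lambda>f x. vector_derivative f (at x)) ^^ k"

text \<open>\<open>W \<cdot> D\<close> for a smooth matrix-valued function \<open>W\<close>.\<close>

definition dop_act_fun :: "(real \<Rightarrow> 'n::finite cmat) \<Rightarrow> 'n dop \<Rightarrow> real \<Rightarrow> 'n cmat"
  where "dop_act_fun W D x = (\<Sum>i\<le>degree D. nth_deriv i W x ** pm_eval (coeff D i) x)"

definition degree_preserving :: "'n::finite dop \<Rightarrow> bool"
  where "degree_preserving E \<longleftrightarrow> (\<forall>\<^sub>\<infinity>n. \<forall>f. has_degree f n \<longrightarrow> has_degree (dop_act f E) n)"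


section \<open>Weight matrices and orthogonal polynomials\<close>

text \<open>Weights are total functions, of which only the values on the open interval
  \<open>einterval a b\<close> matter.\<close>

definition weight_matrix :: "ereal \<Rightarrow> ereal \<Rightarrow> (real \<Rightarrow> 'n::finite cmat) \<Rightarrow> bool"
  where "weight_matrix a b W \<longleftrightarrow>
     (\<forall>k. nth_deriv k W differentiable_on einterval a b) \<and>
     (AE x in lborel. x \<in> einterval a b \<longrightarrow> posdef (W x)) \<and>
     (\<forall>k. set_integrable lborel (einterval a b) (\<lambda>x. x ^ k *\<^sub>R W x))"

definition weight_inner ::
    "ereal \<Rightarrow> ereal \<Rightarrow> (real \<Rightarrow> 'n::finite cmat) \<Rightarrow> 'n pmat \<Rightarrow> 'n pmat \<Rightarrow> 'n cmat"
  where "weight_inner a b W P Q =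
     (LINT x:einterval a b|lborel. pm_eval P x ** W x ** herm (pm_eval Q x))"

definition orthogonal_seq ::
    "ereal \<Rightarrow> ereal \<Rightarrow> (real \<Rightarrow> 'n::finite cmat) \<Rightarrow> (nat \<Rightarrow> 'n pmat) \<Rightarrow> bool"
  where "orthogonal_seq a b W P \<longleftrightarrow>
     (\<forall>n. has_degree (P n) n \<and> invertible (pm_coeff (P n) n)) \<and>
     (\<forall>n m. n \<noteq> m \<longrightarrow> weight_inner a b W (P n) (P m) = 0)"

text \<open>The condition defining \<open>\<D>(W)\<close> does not depend on the orthogonal sequence; it is imposed
  here on all of them.\<close>

definition dop_algebra :: "ereal \<Rightarrow> ereal \<Rightarrow> (real \<Rightarrow> 'n::finite cmat) \<Rightarrow> 'n dop set"
  where "dop_algebra a b W = {D. \<forall>P. orthogonal_seq a b W P \<longrightarrow>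
     (\<forall>n. \<exists>\<Lambda>. dop_act (P n) D = pm_const \<Lambda> ** P n)}"

text \<open>The integral of a non-integrable function is \<open>0\<close> in the library, so convergence of
  the integral of \<open>P (W \<cdot> D)\<close> is required explicitly. The integral of \<open>P A W\<close> always converges
  since the moments are finite.\<close>

definition good_enough :: "ereal \<Rightarrow> ereal \<Rightarrow> (real \<Rightarrow> 'n::finite cmat) \<Rightarrow> bool"
  where "good_enough a b W \<longleftrightarrow>
     (\<forall>D A. (\<forall>P. set_integrable lborel (einterval a b) (\<lambda>x. pm_eval P x ** dop_act_fun W D x) \<and>
          (LINT x:einterval a b|lborel. pm_eval P x ** pm_eval A x ** W x) =
          (LINT x:einterval a b|lborel. pm_eval P x ** dop_act_fun W D x)) \<longrightarrow>
        (\<forall>x\<in>einterval a b. pm_eval A x ** W x = dop_act_fun W D x))"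

definition direct_sum ::
    "(real \<Rightarrow> 'n::finite cmat) \<Rightarrow> (real \<Rightarrow> 'm::finite cmat) \<Rightarrow> real \<Rightarrow> ('n + 'm) cmat"
  where "direct_sum W V x = (\<chi> i j. case (i, j) of
       (Inl k, Inl l) \<Rightarrow> W x $ k $ l
     | (Inr k, Inr l) \<Rightarrow> V x $ k $ l
     | _ \<Rightarrow> 0)"

text \<open>The class of weights under consideration. For direct sums of more than two weights of the
  class the good-enough condition follows from the one for pairs, because it decouples into
  separate conditions on the blocks \<open>(i, j)\<close> of \<open>D\<close> and \<open>A\<close>.\<close>

definition good_weights :: "ereal \<Rightarrow> ereal \<Rightarrow> (real \<Rightarrow> 'n::finite cmat) set \<Rightarrow> bool"
  where "good_weights a b \<W> \<longleftrightarrow>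
     (\<forall>W\<in>\<W>. weight_matrix a b W \<and> good_enough a b W) \<and>
     (\<forall>W\<in>\<W>. \<forall>V\<in>\<W>. good_enough a b (direct_sum W V))"


section \<open>Darboux transformations\<close>

definition darboux ::
    "ereal \<Rightarrow> ereal \<Rightarrow> (real \<Rightarrow> 'n::finite cmat) \<Rightarrow> (nat \<Rightarrow> 'n pmat) \<Rightarrow> (nat \<Rightarrow> 'n pmat) \<Rightarrow> bool"
  where "darboux a b W P Q \<longleftrightarrow>
     (\<exists>D\<in>dop_algebra a b W. \<exists>V N. degree_preserving V \<and> degree_preserving N \<and> D = dop_mult V N \<and>
        (\<forall>n. \<exists>A. dop_act (P n) V = pm_const A ** Q n))"

definition orthogonal_seqs :: "ereal \<Rightarrow> ereal \<Rightarrow> (real \<Rightarrow> 'n::finite cmat) set \<Rightarrow> (nat \<Rightarrow> 'n pmat) set"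
  where "orthogonal_seqs a b \<W> = {P. \<exists>W\<in>\<W>. orthogonal_seq a b W P}"

definition darboux_rel ::
    "ereal \<Rightarrow> ereal \<Rightarrow> (real \<Rightarrow> 'n::finite cmat) set \<Rightarrow> ((nat \<Rightarrow> 'n pmat) \<times> (nat \<Rightarrow> 'n pmat)) set"
  where "darboux_rel a b \<W> = {(P, Q). \<exists>W\<in>\<W>. \<exists>V\<in>\<W>.
     orthogonal_seq a b W P \<and> orthogonal_seq a b V Q \<and> darboux a b W P Q}"


section \<open>The product is composition\<close>

lemma pm_deriv_0 [simp]: "pm_deriv 0 = 0"
  by (simp add: pm_deriv_def vec_eq_iff)

lemma pm_deriv_add: "pm_deriv (P + Q) = pm_deriv P + pm_deriv Q"
  by (simp add: pm_deriv_def vec_eq_iff pderiv_add)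

lemma pderiv_sum_poly: "pderiv (sum f A) = (\<Sum>i\<in>A. pderiv (f i :: complex poly))"
  by (induction A rule: infinite_finite_induct) (auto simp: pderiv_add)

lemma pm_deriv_mult: "pm_deriv (P ** Q) = pm_deriv P ** Q + P ** pm_deriv Q"
  by (simp add: pm_deriv_def matrix_matrix_mult_def vec_eq_iff pderiv_sum_poly pderiv_mult
      sum.distrib algebra_simps)

lemma pm_deriv_pow_0 [simp]: "(pm_deriv ^^ k) 0 = 0"
  by (induction k) auto

lemma pm_deriv_pow_add: "(pm_deriv ^^ k) (P + Q) = (pm_deriv ^^ k) P + (pm_deriv ^^ k) Q"
  by (induction k) (auto simp: pm_deriv_add)

lemma pm_deriv_pow_sum: "(pm_deriv ^^ k) (sum f A) = (\<Sum>i\<in>A. (pm_deriv ^^ k) (f i))"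
  by (induction A rule: infinite_finite_induct) (auto simp: pm_deriv_pow_add)

lemma pmat_sum_mult: "sum f A ** (Q :: 'n::finite pmat) = (\<Sum>i\<in>A. f i ** Q)"
  by (simp add: matrix_matrix_mult_def vec_eq_iff sum_distrib_right) (auto intro: sum.swap)

lemma mat_of_nat_mult: "mat (of_nat c) ** (Q :: 'n::finite pmat) = (\<chi> i j. of_nat c * Q $ i $ j)"
  by (simp add: mat_def matrix_matrix_mult_def vec_eq_iff if_distrib if_distribR sum.delta cong: if_cong)

lemma pmat_mult_mat_of_nat:
  "(P :: 'n pmat) ** (mat (of_nat c) ** (Q :: 'n::finite pmat)) = mat (of_nat c) ** (P ** Q)"
  unfolding mat_of_nat_mult
  by (simp add: matrix_matrix_mult_def vec_eq_iff sum_distrib_left algebra_simps)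

lemma pm_deriv_of_nat [simp]: "pm_deriv (mat (of_nat c)) = 0"
  by (simp add: pm_deriv_def mat_def vec_eq_iff)

lemma mat_of_nat_add: "mat (of_nat (c + d)) ** (Q :: 'n::finite pmat) =
    mat (of_nat c) ** Q + mat (of_nat d) ** Q"
  unfolding mat_of_nat_mult by (simp add: vec_eq_iff algebra_simps)

lemma pm_deriv_sum: "pm_deriv (sum f A) = (\<Sum>i\<in>A. pm_deriv (f i))"
  using pm_deriv_pow_sum[of 1 f A] by simp

lemma pm_deriv_pow_mult:
  "(pm_deriv ^^ j) (P ** Q) =
     (\<Sum>k\<le>j. mat (of_nat (j choose k)) ** ((pm_deriv ^^ k) P ** (pm_deriv ^^ (j - k)) Q))"
proof (induction j)
  case 0
  show ?case by (simp add: mat_of_nat_mult vec_eq_iff)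
next
  case (Suc j)
  let ?t = "\<lambda>k l. (pm_deriv ^^ k) P ** (pm_deriv ^^ l) Q"
  let ?c = "\<lambda>c X. mat (of_nat c) ** (X :: 'a pmat)"
  have "(pm_deriv ^^ Suc j) (P ** Q) = (\<Sum>k\<le>j. ?c (j choose k) (?t (Suc k) (j - k)))
      + (\<Sum>k\<le>j. ?c (j choose k) (?t k (Suc j - k)))"
    by (simp add: Suc.IH pm_deriv_sum pm_deriv_mult matrix_add_ldistrib sum.distrib
        Suc_diff_le)
  also have "(\<Sum>k\<le>j. ?c (j choose k) (?t k (Suc j - k))) =
      (\<Sum>k\<le>Suc j. ?c (j choose k) (?t k (Suc j - k)))"
    by (simp add: mat_of_nat_mult vec_eq_iff)
  also have "\<dots> = ?c 1 (?t 0 (Suc j)) + (\<Sum>k\<le>j. ?c (j choose Suc k) (?t (Suc k) (j - k)))"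
    by (subst sum.atMost_Suc_shift) simp
  also have "(\<Sum>k\<le>j. ?c (j choose k) (?t (Suc k) (j - k))) +
      (?c 1 (?t 0 (Suc j)) + (\<Sum>k\<le>j. ?c (j choose Suc k) (?t (Suc k) (j - k)))) =
      ?c 1 (?t 0 (Suc j)) + (\<Sum>k\<le>j. ?c (Suc j choose Suc k) (?t (Suc k) (j - k)))"
    by (simp only: binomial_Suc_Suc mat_of_nat_add sum.distrib add_ac)
  also have "\<dots> = (\<Sum>k\<le>Suc j. ?c (Suc j choose k) (?t k (Suc j - k)))"
    by (subst sum.atMost_Suc_shift) simp
  finally show ?case .
qed

lemma dop_act_bound:
  assumes "degree D \<le> n"
  shows "dop_act P D = (\<Sum>i\<le>n. (pm_deriv ^^ i) P ** coeff D i)"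
  unfolding dop_act_def using assms
  by (intro sum.mono_neutral_left) (auto simp: coeff_eq_0 not_le)

lemma dop_act_add: "dop_act P (D + E) = dop_act P D + dop_act P E"
proof -
  define n where "n = max (degree (D + E)) (max (degree D) (degree E))"
  have "degree (D + E) \<le> n" "degree D \<le> n" "degree E \<le> n" by (auto simp: n_def)
  then show ?thesis
    by (simp add: dop_act_bound[of _ n] matrix_add_ldistrib sum.distrib)
qed

lemma dop_act_0 [simp]: "dop_act P 0 = 0"
  by (simp add: dop_act_def)

lemma dop_act_sum: "dop_act P (sum f A) = (\<Sum>i\<in>A. dop_act P (f i))"
  by (induction A rule: infinite_finite_induct) (auto simp: dop_act_add)

lemma dop_act_monom: "dop_act P (monom F i) = (pm_deriv ^^ i) P ** F"
proof -
  have "dop_act P (monom F i) = (\<Sum>k\<le>i. if k = i then (pm_deriv ^^ i) P ** F else 0)"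
    unfolding dop_act_bound[OF degree_monom_le] by (intro sum.cong) auto
  then show ?thesis by simp
qed

lemma dop_act_mult: "dop_act P (dop_mult D E) = dop_act (dop_act P D) E"
proof -
  have "dop_act (dop_act P D) E = (\<Sum>j\<le>degree E. \<Sum>i\<le>degree D.
      (pm_deriv ^^ j) ((pm_deriv ^^ i) P ** coeff D i) ** coeff E j)"
    by (simp add: dop_act_def pm_deriv_pow_sum pmat_sum_mult)
  also have "\<dots> = (\<Sum>i\<le>degree D. \<Sum>j\<le>degree E.
      (pm_deriv ^^ j) ((pm_deriv ^^ i) P ** coeff D i) ** coeff E j)"
    by (rule sum.swap)
  also have "\<dots> = dop_act P (dop_mult D E)"
    unfolding dop_mult_def dop_act_sum dop_act_monom pm_deriv_pow_mult pmat_sum_mult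
    by (intro sum.cong refl)
      (simp add: pmat_mult_mat_of_nat matrix_mul_assoc[symmetric] funpow_add[symmetric]
        flip: funpow_add[THEN fun_cong, unfolded comp_def] add: add.commute)
  finally show ?thesis ..
qed

end

(* The multiplication by x is symmetric for the inner product of a weight, and a linear map on matrix
   polynomials that commutes with constant left factors is a differential operator of order at most s
   iff its (s+1)-fold commutator with x vanishes. Hence the algebraic adjoint of an operator V with
   P_n V = A_n Q_n, which maps Q_n to B_n P_n with B_n a twisted conjugate of A_n, is again a
   differential operator U, and it is degree-preserving if V is. So a Darboux transformation exists
   as soon as there is a degree-preserving V with P_n V = A_n Q_n (take D = V U); adjoints give
   symmetry and products give transitivity. *)

theory Submission
  imports Defs
begin

section \<open>Matrices of polynomials\<close>

text \<open>The variable x as a scalar matrix, so that multiplication by x is an instance of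
  \<open>**\<close> and, by \<open>mult_mat_scalar\<close>, commutes with every matrix
  factor.\<close>

abbreviation pm_X :: "'n::finite pmat"
  where "pm_X \<equiv> mat [:0, 1:]"

lemma mat_scalar_mult:
  fixes Q :: "'a::comm_ring_1^'n::finite^'n"
  shows "mat c ** Q = (\<chi> i j. c * Q $ i $ j)"
  by (simp add: mat_def matrix_matrix_mult_def vec_eq_iff if_distrib if_distribR cong: if_cong)

lemma mult_mat_scalar:
  fixes P Q :: "'a::comm_ring_1^'n::finite^'n"
  shows "P ** (mat c ** Q) = mat c ** (P ** Q)"
  unfolding mat_scalar_mult
  by (simp add: matrix_matrix_mult_def vec_eq_iff sum_distrib_left algebra_simps)

lemma matrix_diff_ldistrib:
  fixes A :: "'a::ring_1^'n::finite^'m"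
  shows "A ** (B - C) = A ** B - A ** C"
  by (simp add: matrix_matrix_mult_def vec_eq_iff right_diff_distrib sum_subtractf)

lemma matrix_add_rdistrib:
  fixes A :: "'a::semiring_1^'n::finite^'m"
  shows "(A + B) ** C = A ** C + B ** C"
  by (simp add: matrix_matrix_mult_def vec_eq_iff distrib_right sum.distrib)

lemma matrix_sum_ldistrib:
  fixes A :: "'a::ring_1^'n::finite^'m"
  shows "A ** (\<Sum>i\<in>I. f i) = (\<Sum>i\<in>I. A ** f i)"
  by (induction I rule: infinite_finite_induct) (auto simp: matrix_add_ldistrib)

lemma pm_const_mult: "pm_const (A ** B) = pm_const A ** pm_const B"
proof -
  have "[:sum f S:] = (\<Sum>i\<in>S. [:f i:])" for f :: "'a \<Rightarrow> complex" and S
    by (simp add: poly_eq_iff coeff_sum coeff_pCons split: nat.split)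
  then show ?thesis
    by (simp add: pm_const_def matrix_matrix_mult_def vec_eq_iff mult.commute)
qed

lemma pm_const_1 [simp]: "pm_const (mat 1) = mat 1"
  by (simp add: pm_const_def mat_def vec_eq_iff)

lemma pm_const_0 [simp]: "pm_const 0 = 0"
  by (simp add: pm_const_def vec_eq_iff)

lemma pm_deriv_const [simp]: "pm_deriv (pm_const A) = 0"
  by (simp add: pm_deriv_def pm_const_def vec_eq_iff)

lemma pm_deriv_pow_const_mult:
  "(pm_deriv ^^ i) (pm_const A ** P) = pm_const A ** (pm_deriv ^^ i) P"
  by (induction i) (auto simp: pm_deriv_mult)

lemma pm_deriv_X: "pm_deriv pm_X = mat 1"
  by (simp add: pm_deriv_def mat_def vec_eq_iff pderiv_pCons)

text \<open>In the Leibniz rule only two terms survive, because the second derivative of x is 0.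
  Order 0 is excluded, so no predecessor occurs.\<close>

lemma pm_deriv_pow_X_mult:
  "(pm_deriv ^^ Suc i) (pm_X ** P) =
     pm_X ** (pm_deriv ^^ Suc i) P + mat (of_nat (Suc i)) ** (pm_deriv ^^ i) P"
proof (induction i)
  case 0
  show ?case by (simp add: pm_deriv_mult pm_deriv_X)
next
  case (Suc i)
  have "(pm_deriv ^^ Suc (Suc i)) (pm_X ** P) = pm_deriv ((pm_deriv ^^ Suc i) (pm_X ** P))"
    by simp
  also have "\<dots> = pm_X ** (pm_deriv ^^ Suc (Suc i)) P +
      (mat (of_nat 1) ** (pm_deriv ^^ Suc i) P + mat (of_nat (Suc i)) ** (pm_deriv ^^ Suc i) P)"
    unfolding Suc.IH pm_deriv_add pm_deriv_mult pm_deriv_X pm_deriv_of_nat by simp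
  also have "mat (of_nat 1) ** (pm_deriv ^^ Suc i) P + mat (of_nat (Suc i)) ** (pm_deriv ^^ Suc i) P
      = mat (of_nat (Suc (Suc i))) ** (pm_deriv ^^ Suc i) P"
    by (simp only: mat_of_nat_add[symmetric]) simp
  finally show ?case .
qed

lemma pm_coeff_add: "pm_coeff (P + Q) k = pm_coeff P k + pm_coeff Q k"
  by (simp add: pm_coeff_def vec_eq_iff)

lemma pm_coeff_diff: "pm_coeff (P - Q) k = pm_coeff P k - pm_coeff Q k"
  by (simp add: pm_coeff_def vec_eq_iff)

lemma pm_coeff_0 [simp]: "pm_coeff 0 k = 0"
  by (simp add: pm_coeff_def vec_eq_iff)

lemma pm_coeff_const_mult: "pm_coeff (pm_const A ** P) k = A ** pm_coeff P k"
  by (simp add: pm_coeff_def pm_const_def matrix_matrix_mult_def vec_eq_iff coeff_sum)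

lemma pm_eqI: "(\<And>k. pm_coeff P k = pm_coeff Q k) \<Longrightarrow> P = Q"
  by (simp add: pm_coeff_def vec_eq_iff poly_eq_iff)

lemma pm_coeff_X_mult:
  "pm_coeff (pm_X ** P) k = (case k of 0 \<Rightarrow> 0 | Suc l \<Rightarrow> pm_coeff P l)"
  unfolding mat_scalar_mult by (auto simp: pm_coeff_def vec_eq_iff split: nat.split)

lemma pm_coeff_const: "pm_coeff (pm_const A) k = (if k = 0 then A else 0)"
  by (auto simp: pm_coeff_def pm_const_def vec_eq_iff coeff_pCons split: nat.split)


subsection \<open>Degrees\<close>

text \<open>A strict bound also covers the zero polynomial, which has no degree; the bound 0
  characterizes it and serves as base of the inductions.\<close>

definition degree_less :: "'n::finite pmat \<Rightarrow> nat \<Rightarrow> bool"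
  where "degree_less P n \<longleftrightarrow> (\<forall>k\<ge>n. pm_coeff P k = 0)"

lemma degree_less_0: "degree_less P 0 \<longleftrightarrow> P = 0"
  unfolding degree_less_def by (auto intro!: pm_eqI)

lemma degree_less_add: "degree_less P n \<Longrightarrow> degree_less Q n \<Longrightarrow> degree_less (P + Q) n"
  by (simp add: degree_less_def pm_coeff_add)

lemma degree_less_const_mult: "degree_less P n \<Longrightarrow> degree_less (pm_const A ** P) n"
  by (simp add: degree_less_def pm_coeff_const_mult)

lemma degree_less_mono: "degree_less P n \<Longrightarrow> n \<le> m \<Longrightarrow> degree_less P m"
  by (simp add: degree_less_def)

lemma has_degree_iff: "has_degree P n \<longleftrightarrow> pm_coeff P n \<noteq> 0 \<and> degree_less P (Suc n)"
  by (auto simp: has_degree_def degree_less_def Suc_le_eq)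

lemma degree_less_exists: "\<exists>n. degree_less P n"
proof -
  have "finite (range (\<lambda>(i, j). degree (P $ i $ j)))" by simp
  then obtain n where "\<forall>d \<in> range (\<lambda>(i, j). degree (P $ i $ j)). d < n"
    unfolding finite_nat_set_iff_bounded by blast
  then have "degree (P $ i $ j) < n" for i j by (auto simp: image_iff)
  then have "degree_less P n"
    by (auto simp: degree_less_def pm_coeff_def vec_eq_iff intro!: coeff_eq_0 intro: less_le_trans)
  then show ?thesis ..
qed

text \<open>Horner's scheme: every polynomial is x R plus a constant matrix, where R has a smaller
  degree bound.\<close>

lemma pmat_induct [case_names const X add]:
  assumes const: "\<And>A. S (pm_const A)" and X: "\<And>P. S P \<Longrightarrow> S (pm_X ** P)"
    and add: "\<And>P Q. S P \<Longrightarrow> S Q \<Longrightarrow> S (P + Q)"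
  shows "S P"
proof -
  have "S P" if "degree_less P n" for n P
    using that
  proof (induction n arbitrary: P)
    case 0
    then show ?case using const[of 0] by (simp add: degree_less_0)
  next
    case (Suc n)
    \<comment> \<open>Dropping the constant coefficient of each entry divides P - P(0) by x.\<close>
    define R :: "'a pmat" where "R = (\<chi> i j. poly_shift 1 (P $ i $ j))"
    have "pm_coeff R k = pm_coeff P (Suc k)" for k
      by (simp add: R_def pm_coeff_def coeff_poly_shift)
    then have "degree_less R n" "P = pm_X ** R + pm_const (pm_coeff P 0)"
      using Suc.prems
      by (auto simp: degree_less_def pm_coeff_add pm_coeff_X_mult pm_coeff_const
          intro!: pm_eqI split: nat.split)
    then show ?case using Suc.IH X add const by metis
  qed
  then show ?thesis using degree_less_exists by blast
qed

section \<open>Expansion in sequences with nonsingular leading coefficients\<close>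

definition nonsingular_seq :: "(nat \<Rightarrow> 'n::finite pmat) \<Rightarrow> bool"
  where "nonsingular_seq P \<longleftrightarrow> (\<forall>n. degree_less (P n) (Suc n) \<and> invertible (pm_coeff (P n) n))"

text \<open>Multiplying coefficient n of f on the right by the inverse of that of P_n yields the C
  for which f - C P_n has no terms of degree n or more.\<close>

lemma nonsingular_seq_split:
  assumes "nonsingular_seq P" "degree_less f (Suc n)"
  obtains C g where "f = pm_const C ** P n + g" "degree_less g n"
    "pm_coeff f n = C ** pm_coeff (P n) n"
proof -
  obtain M where M: "M ** pm_coeff (P n) n = mat 1"
    using assms by (auto simp: nonsingular_seq_def invertible_def)
  let ?C = "pm_coeff f n ** M"
  have C: "?C ** pm_coeff (P n) n = pm_coeff f n"
    by (simp add: M flip: matrix_mul_assoc)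
  have "pm_coeff (f - pm_const ?C ** P n) k = 0" if "k \<ge> n" for k
  proof (cases "k = n")
    case True
    then show ?thesis using C by (simp add: pm_coeff_diff pm_coeff_const_mult)
  next
    case False
    then show ?thesis using assms that
      by (simp add: pm_coeff_diff pm_coeff_const_mult degree_less_def nonsingular_seq_def)
  qed
  then show thesis
    using C by (intro that[of ?C "f - pm_const ?C ** P n"]) (auto simp: degree_less_def)
qed

text \<open>Repeated splitting writes f as a sum of terms C_n P_n with n < m. Keeping this
  restriction on n is what later gives orthogonality to lower degrees and degree bounds.\<close>

lemma nonsingular_seq_induct_degree:
  assumes P: "nonsingular_seq P" and f: "degree_less f m"
    and zero: "S 0" and add: "\<And>f g. S f \<Longrightarrow> S g \<Longrightarrow> S (f + g)"
    and seq: "\<And>C n. n < m \<Longrightarrow> S (pm_const C ** P n)"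
  shows "S f"
  using f seq
proof (induction m arbitrary: f)
  case 0
  then show ?case using zero by (simp add: degree_less_0)
next
  case (Suc n)
  obtain C g where "f = pm_const C ** P n + g" "degree_less g n"
    using nonsingular_seq_split[OF P Suc.prems(1)] .
  then show ?case using Suc.IH[of g] Suc.prems(2) add by (metis less_Suc_eq)
qed

lemma nonsingular_seq_induct [consumes 1, case_names zero add seq]:
  assumes P: "nonsingular_seq P"
    and zero: "S 0" and add: "\<And>f g. S f \<Longrightarrow> S g \<Longrightarrow> S (f + g)"
    and seq: "\<And>C n. S (pm_const C ** P n)"
  shows "S f"
  using degree_less_exists[of f] nonsingular_seq_induct_degree[OF P, of f _ S] zero add seq
  by blast

lemma invertible_if_left_kernel:
  fixes M :: "'n::finite cmat"
  assumes "\<And>C :: 'n cmat. C ** M = 0 \<Longrightarrow> C = 0"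
  shows "invertible M"
proof -
  have "v = 0" if "transpose M *v v = 0" for v :: "complex^'n"
  proof -
    from that have "v v* M = 0" by simp
    \<comment> \<open>A row vector v in the left kernel becomes a matrix in the left kernel by
      repeating v in every row.\<close>
    then have "(\<chi> i. v) ** M = 0"
      by (simp add: vec_eq_iff vector_matrix_mult_def matrix_matrix_mult_def mult.commute)
    from assms[OF this] show "v = 0" by (simp add: vec_eq_iff)
  qed
  then obtain B where "B ** transpose M = mat 1"
    using matrix_left_invertible_ker by blast
  then have "M ** transpose B = mat 1"
    by (metis matrix_transpose_mul transpose_mat transpose_transpose)
  then show ?thesis
    unfolding invertible_right_inverse by blast
qed

lemma invertible_mult_right_cancel:
  assumes "invertible M" "C ** M = (0 :: 'n::finite cmat)"
  shows "C = 0"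
proof -
  obtain N where "M ** N = mat 1" using assms(1) by (auto simp: invertible_def)
  then have "C = (C ** M) ** N" by (simp flip: matrix_mul_assoc)
  then show ?thesis using assms(2) by simp
qed


section \<open>Differential operators as linear maps\<close>

text \<open>Linearity over constant matrices acting from the left, the natural one for operators
  that act on the right.\<close>

definition left_linear :: "('n::finite pmat \<Rightarrow> 'n pmat) \<Rightarrow> bool"
  where "left_linear T \<longleftrightarrow> (\<forall>P Q. T (P + Q) = T P + T Q) \<and>
    (\<forall>A P. T (pm_const A ** P) = pm_const A ** T P)"

lemma left_linearI [intro?]:
  "(\<And>P Q. T (P + Q) = T P + T Q) \<Longrightarrow> (\<And>A P. T (pm_const A ** P) = pm_const A ** T P) \<Longrightarrow>
    left_linear T"
  by (simp add: left_linear_def)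

lemma left_linear_add: "left_linear T \<Longrightarrow> T (P + Q) = T P + T Q"
  and left_linear_const_mult: "left_linear T \<Longrightarrow> T (pm_const A ** P) = pm_const A ** T P"
  by (simp_all add: left_linear_def)

lemma left_linear_0: "left_linear T \<Longrightarrow> T 0 = 0"
  using left_linear_const_mult[of T 0 0] by simp

lemma left_linear_dop_act: "left_linear (\<lambda>P. dop_act P D)"
proof
  fix P Q A
  show "dop_act (P + Q) D = dop_act P D + dop_act Q D"
    by (simp add: dop_act_def pm_deriv_pow_add matrix_add_rdistrib sum.distrib)
  show "dop_act (pm_const A ** P) D = pm_const A ** dop_act P D"
    by (simp add: dop_act_def pm_deriv_pow_const_mult matrix_sum_ldistrib matrix_mul_assoc)
qed

lemma left_linear_diff:
  assumes "left_linear S" "left_linear T"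
  shows "left_linear (\<lambda>P. S P - T P)"
  using assms by (auto simp: left_linear_def matrix_diff_ldistrib)

section \<open>Commutators with multiplication by x\<close>

definition ad_X :: "('n::finite pmat \<Rightarrow> 'n pmat) \<Rightarrow> 'n pmat \<Rightarrow> 'n pmat"
  where "ad_X T P = T (pm_X ** P) - pm_X ** T P"

lemma left_linear_ad_X:
  assumes "left_linear T"
  shows "left_linear (ad_X T)"
  using assms
  by (auto simp: left_linear_def ad_X_def matrix_add_ldistrib matrix_diff_ldistrib
      mult_mat_scalar[of "pm_const _", symmetric])

text \<open>Passing to adjoints changes the sign of a commutator with x; the sign has to be carried
  through iterated commutators.\<close>

lemma ad_X_uminus: "(ad_X ^^ k) (\<lambda>P. - T P) = (\<lambda>P. - (ad_X ^^ k) T P)"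
proof (induction k)
  case (Suc k)
  have "pm_X ** (- P) = - (pm_X ** P)" for P :: "'a pmat"
    using matrix_diff_ldistrib[of pm_X 0 P] by simp
  then have "ad_X (\<lambda>P. - S P) = (\<lambda>P. - ad_X S P)" for S :: "'a pmat \<Rightarrow> 'a pmat"
    by (simp add: ad_X_def fun_eq_iff)
  then show ?case by (simp add: Suc.IH)
qed simp

text \<open>The commutator with x is the formal derivative of D with respect to \<partial>, hence
  lowers the order by one.\<close>

lemma dop_act_X_mult:
  assumes "degree D \<le> Suc s"
  shows "dop_act (pm_X ** P) D = pm_X ** dop_act P D +
    dop_act P (\<Sum>i\<le>s. monom (mat (of_nat (Suc i)) ** coeff D (Suc i)) i)"
proof -
  have "dop_act (pm_X ** P) D = (pm_X ** P) ** coeff D 0 +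
      (\<Sum>i\<le>s. (pm_deriv ^^ Suc i) (pm_X ** P) ** coeff D (Suc i))"
    unfolding dop_act_bound[OF assms] by (subst sum.atMost_Suc_shift) simp
  also have "\<dots> = (pm_X ** (P ** coeff D 0) +
      (\<Sum>i\<le>s. pm_X ** ((pm_deriv ^^ Suc i) P ** coeff D (Suc i)))) +
      (\<Sum>i\<le>s. (pm_deriv ^^ i) P ** (mat (of_nat (Suc i)) ** coeff D (Suc i)))"
    unfolding pm_deriv_pow_X_mult matrix_add_rdistrib sum.distrib mult_mat_scalar
    by (simp only: matrix_mul_assoc add.assoc)
  also have "pm_X ** (P ** coeff D 0) +
      (\<Sum>i\<le>s. pm_X ** ((pm_deriv ^^ Suc i) P ** coeff D (Suc i))) = pm_X ** dop_act P D"
    unfolding dop_act_bound[OF assms]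
    by (subst sum.atMost_Suc_shift) (simp add: matrix_add_ldistrib matrix_sum_ldistrib)
  finally show ?thesis by (simp only: dop_act_sum dop_act_monom)
qed

text \<open>After s commutators an operator of order 0 remains. It is right multiplication by a
  polynomial matrix, which commutes with x, so one more commutator kills it.\<close>

lemma ad_X_dop_act_eq_0:
  "degree D \<le> s \<Longrightarrow> (ad_X ^^ Suc s) (\<lambda>P. dop_act P D) = (\<lambda>_. 0)"
proof (induction s arbitrary: D)
  case 0
  then show ?case
    by (simp add: ad_X_def dop_act_def matrix_mul_assoc fun_eq_iff)
next
  case (Suc s)
  let ?E = "\<Sum>i\<le>s. monom (mat (of_nat (Suc i)) ** coeff D (Suc i)) i"
  have "degree ?E \<le> s"
    by (intro degree_sum_le) (auto intro: order_trans[OF degree_monom_le])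
  moreover have "ad_X (\<lambda>P. dop_act P D) = (\<lambda>P. dop_act P ?E)"
    using dop_act_X_mult[OF Suc.prems] by (simp add: ad_X_def fun_eq_iff)
  ultimately show ?case
    using Suc.IH[of ?E] by (subst funpow_Suc_right) simp
qed

text \<open>Commuting with constant left factors and with x, the map T commutes with all polynomial
  left factors; now write P as P times the identity.\<close>

lemma left_linear_commute_X:
  assumes T: "left_linear T" and "ad_X T = (\<lambda>_. 0)"
  shows "T P = P ** T (mat 1)"
proof (induction P rule: pmat_induct)
  case (const A)
  then show ?case using left_linear_const_mult[OF T, of A "mat 1"] by simp
next
  case (X P)
  then show ?case using assms(2) by (simp add: fun_eq_iff ad_X_def matrix_mul_assoc)
next
  case (add P Q)
  then show ?case by (simp add: left_linear_add[OF T] matrix_add_rdistrib)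
qed

text \<open>Every operator is a commutator with \<open>x\<close>, because it can be integrated formally with respect
  to \<open>\<partial>\<close>. This reduces the order by one.\<close>

lemma ad_X_nilpotent_imp_dop:
  "left_linear T \<Longrightarrow> (ad_X ^^ s) T = (\<lambda>_. 0) \<Longrightarrow> \<exists>E. \<forall>P. T P = dop_act P E"
proof (induction s arbitrary: T)
  case 0
  then show ?case by (auto intro: exI[of _ 0])
next
  case (Suc s)
  have "(ad_X ^^ s) (ad_X T) = (\<lambda>_. 0)"
    using Suc.prems(2) by (subst (asm) funpow_Suc_right) simp
  then obtain G where G: "ad_X T P = dop_act P G" for P
    using Suc.IH left_linear_ad_X[OF Suc.prems(1)] by blast
  \<comment> \<open>Formal integration in \<partial>: the term of order i moves to order i + 1 and
    is divided by i + 1.\<close>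
  let ?m = "\<lambda>i. monom (mat [:1 / of_nat (Suc i):] ** coeff G i) (Suc i)"
  define E where "E = (\<Sum>i\<le>degree G. ?m i)"
  have inv: "mat [:1 / of_nat (Suc i):] ** (mat (of_nat (Suc i)) ** R) = R"
    for i and R :: "'a pmat"
  proof -
    have "[:1 / of_nat (Suc i):] * of_nat (Suc i) = (1 :: complex poly)"
      by (simp add: of_nat_poly del: of_nat_Suc)
    then show ?thesis
      unfolding mat_scalar_mult by (simp add: vec_eq_iff mult.assoc[symmetric] del: of_nat_Suc)
  qed
  have m: "dop_act (pm_X ** P) (?m i) = pm_X ** dop_act P (?m i) + (pm_deriv ^^ i) P ** coeff G i"
    for P i
  proof -
    have "dop_act (pm_X ** P) (?m i) =
        mat [:1 / of_nat (Suc i):] ** ((pm_deriv ^^ Suc i) (pm_X ** P) ** coeff G i)"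
      by (simp only: dop_act_monom mult_mat_scalar)
    also have "\<dots> = mat [:1 / of_nat (Suc i):] ** (pm_X ** ((pm_deriv ^^ Suc i) P ** coeff G i)) +
        mat [:1 / of_nat (Suc i):] ** (mat (of_nat (Suc i)) ** ((pm_deriv ^^ i) P ** coeff G i))"
      unfolding pm_deriv_pow_X_mult
      by (simp only: matrix_add_rdistrib matrix_add_ldistrib matrix_mul_assoc)
    also have "mat [:1 / of_nat (Suc i):] ** (pm_X ** ((pm_deriv ^^ Suc i) P ** coeff G i)) =
        pm_X ** dop_act P (?m i)"
      by (simp only: dop_act_monom mult_mat_scalar[of pm_X "[:1 / of_nat (Suc i):]"]
          mult_mat_scalar[of "(pm_deriv ^^ Suc i) P"])
    finally show ?thesis by (simp only: inv)
  qed
  have "ad_X (\<lambda>P. dop_act P E) P = dop_act P G" for P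
    unfolding ad_X_def E_def dop_act_sum m
    by (simp add: sum.distrib matrix_sum_ldistrib dop_act_def del: of_nat_Suc)
  \<comment> \<open>The difference of T and the integrated operator commutes with x, so it is right
    multiplication by some F, an operator of order 0.\<close>
  then have "ad_X (\<lambda>P. T P - dop_act P E) = (\<lambda>_. 0)"
    using G by (auto simp: ad_X_def fun_eq_iff matrix_diff_ldistrib algebra_simps)
  then obtain F where "T P - dop_act P E = P ** F" for P
    using left_linear_commute_X[OF left_linear_diff[OF Suc.prems(1) left_linear_dop_act]] by blast
  then have "T P = dop_act P (E + monom F 0)" for P
    by (simp add: dop_act_add dop_act_monom diff_eq_eq add.commute)
  then show ?case by blast
qed


section \<open>Matrix-valued inner products and adjoints\<close>

lemma herm_add: "herm (A + B) = herm A + herm B"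
  by (simp add: herm_def vec_eq_iff)

lemma herm_herm [simp]: "herm (herm A) = A"
  by (simp add: herm_def vec_eq_iff)

lemma herm_0 [simp]: "herm 0 = 0"
  by (simp add: herm_def vec_eq_iff)

lemma herm_1 [simp]: "herm (mat 1) = mat 1"
  by (auto simp: herm_def mat_def vec_eq_iff)

lemma herm_mult: "herm (A ** B) = herm B ** herm A"
  by (simp add: herm_def matrix_matrix_mult_def vec_eq_iff mult.commute)

lemma invertible_herm: "invertible A \<Longrightarrow> invertible (herm A)"
  unfolding invertible_def by (metis herm_mult herm_1)

text \<open>The algebraic properties of the inner product of a weight. Symmetry of x is the link
  between adjoints and differential operators.\<close>

locale matrix_form =
  fixes h :: "'n::finite pmat \<Rightarrow> 'n pmat \<Rightarrow> 'n cmat"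
  assumes add_left: "h (P + Q) R = h P R + h Q R"
    and const_mult_left: "h (pm_const A ** P) Q = A ** h P Q"
    and X_symmetric: "h (pm_X ** P) Q = h P (pm_X ** Q)"
    and hermitian: "h Q P = herm (h P Q)"
    and definite: "h P P = 0 \<Longrightarrow> P = 0"
begin

lemma add_right: "h P (Q + R) = h P Q + h P R"
  by (metis hermitian herm_add add_left)

lemma const_mult_right: "h P (pm_const A ** Q) = h P Q ** herm A"
  by (metis hermitian herm_mult const_mult_left)

lemma zero_left [simp]: "h 0 Q = 0"
  using const_mult_left[of 0 0 Q] by simp

lemma zero_right [simp]: "h P 0 = 0"
  using hermitian[of P 0] by simp

lemma diff_left: "h (P - Q) R = h P R - h Q R"
  using add_left[of "P - Q" Q R] by simp

lemma diff_right: "h P (Q - R) = h P Q - h P R"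
  using add_right[of P "Q - R" R] by simp

lemma eqI: "(\<And>P. h P f = h P g) \<Longrightarrow> f = g"
  using definite[of "f - g"] by (simp add: diff_right)

definition orthogonal :: "(nat \<Rightarrow> 'n pmat) \<Rightarrow> bool"
  where "orthogonal P \<longleftrightarrow> nonsingular_seq P \<and> (\<forall>n m. n \<noteq> m \<longrightarrow> h (P n) (P m) = 0)"

text \<open>If C kills the Gram matrix from the left, then C P_n has norm 0 and vanishes; comparing
  leading coefficients gives C = 0.\<close>

lemma invertible_gram:
  assumes "orthogonal P"
  shows "invertible (h (P n) (P n))"
proof (rule invertible_if_left_kernel)
  fix C :: "'n cmat"
  assume "C ** h (P n) (P n) = 0"
  then have "h (pm_const C ** P n) (pm_const C ** P n) = 0"
    by (simp add: const_mult_left const_mult_right matrix_mul_assoc)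
  then have "pm_const C ** P n = 0" by (rule definite)
  then have "C ** pm_coeff (P n) n = 0" by (metis pm_coeff_const_mult pm_coeff_0)
  then show "C = 0"
    using assms invertible_mult_right_cancel by (auto simp: orthogonal_def nonsingular_seq_def)
qed

lemma orthogonal_degree_less:
  assumes P: "orthogonal P" and g: "degree_less g n"
  shows "h g (P n) = 0"
proof -
  have "nonsingular_seq P" using P by (simp add: orthogonal_def)
  from this g show ?thesis
    by (rule nonsingular_seq_induct_degree)
      (use P in \<open>auto simp: orthogonal_def add_left const_mult_left\<close>)
qed

text \<open>Split P'_n as C P_n + g with g of lower degree. Then g is orthogonal to P_n and to P'_n,
  hence to itself, so it is 0.\<close>

lemma orthogonal_unique:
  assumes P: "orthogonal P" and P': "orthogonal P'"
  obtains C where "invertible C" "P' n = pm_const C ** P n"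
proof -
  from P P' have seq: "nonsingular_seq P" and deg: "degree_less (P' n) (Suc n)"
    and inv: "invertible (pm_coeff (P' n) n)"
    by (auto simp: orthogonal_def nonsingular_seq_def)
  obtain C g where C: "P' n = pm_const C ** P n + g" "degree_less g n"
    "pm_coeff (P' n) n = C ** pm_coeff (P n) n"
    using nonsingular_seq_split[OF seq deg] .
  have "h g (P' n) = 0" "h g (P n) = 0"
    using orthogonal_degree_less[OF _ C(2)] P P' by auto
  then have "h g g = 0"
    by (simp add: C(1) add_right const_mult_right)
  then have "P' n = pm_const C ** P n" using definite C(1) by simp
  moreover have "invertible C"
    using inv unfolding C(3) invertible_right_inverse by (metis matrix_mul_assoc)
  ultimately show thesis using that by blast
qed

end

section \<open>Adjoints between two inner products\<close>

locale matrix_form_pair = h: matrix_form h + k: matrix_form k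
  for h k :: "'n::finite pmat \<Rightarrow> 'n pmat \<Rightarrow> 'n cmat"
begin

definition adjoint :: "('n pmat \<Rightarrow> 'n pmat) \<Rightarrow> ('n pmat \<Rightarrow> 'n pmat) \<Rightarrow> bool"
  where "adjoint T S \<longleftrightarrow> (\<forall>p f. k (T p) f = h p (S f))"

text \<open>Since x is symmetric for both forms, taking adjoints reverses the order of the products
  in T x - x T, whence the sign.\<close>

lemma adjoint_ad_X:
  assumes "adjoint T S"
  shows "adjoint (ad_X T) (\<lambda>f. - ad_X S f)"
  using assms
  by (simp add: adjoint_def ad_X_def h.diff_right k.diff_left h.X_symmetric k.X_symmetric)

lemma adjoint_ad_X_nilpotent:
  "adjoint T S \<Longrightarrow> (ad_X ^^ s) T = (\<lambda>_. 0) \<Longrightarrow> (ad_X ^^ s) S = (\<lambda>_. 0)"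
proof (induction s arbitrary: T S)
  case 0
  then show ?case by (auto simp: adjoint_def intro!: h.eqI)
next
  case (Suc s)
  have "(ad_X ^^ s) (ad_X T) = (\<lambda>_. 0)"
    using Suc.prems(2) by (subst (asm) funpow_Suc_right) simp
  from Suc.IH[OF adjoint_ad_X[OF Suc.prems(1)] this]
  have "(ad_X ^^ s) (ad_X S) = (\<lambda>_. 0)"
    by (simp add: ad_X_uminus fun_eq_iff)
  then show ?case by (subst funpow_Suc_right) simp
qed

text \<open>T is diagonal with respect to the orthogonal sequences, so the functional p \<mapsto> k
  (T p) (Q n) sees only the P_n component of p and is represented by a multiple of P_n.\<close>

lemma adjoint_exists:
  assumes P: "h.orthogonal P" and Q: "k.orthogonal Q"
    and T: "left_linear T" and A: "\<And>n. T (P n) = pm_const (A n) ** Q n"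
  obtains S B where "left_linear S" "adjoint T S" "\<And>n. S (Q n) = pm_const (B n) ** P n"
    "\<And>n. invertible (A n) \<Longrightarrow> invertible (B n)"
proof -
  have "\<forall>n. \<exists>N. h (P n) (P n) ** N = mat 1 \<and> N ** h (P n) (P n) = mat 1"
    using h.invertible_gram[OF P] by (simp add: invertible_def)
  then obtain N where N: "\<And>n. h (P n) (P n) ** N n = mat 1" "\<And>n. N n ** h (P n) (P n) = mat 1"
    by metis
  \<comment> \<open>Solves H_n B_n^* = A_n K_n, where H_n and K_n are the Gram matrices of P_n and
    Q_n and N_n is the inverse of H_n.\<close>
  define B where "B n = herm (N n ** (A n ** k (Q n) (Q n)))" for n
  have P_seq: "nonsingular_seq P" and Q_seq: "nonsingular_seq Q"
    using P Q by (auto simp: h.orthogonal_def k.orthogonal_def)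
  have B: "k (T p) (Q n) = h p (pm_const (B n) ** P n)" for p n
    using P_seq
  proof (induction p rule: nonsingular_seq_induct)
    case zero
    then show ?case by (simp add: left_linear_0[OF T])
  next
    case (add f g)
    then show ?case by (simp add: left_linear_add[OF T] h.add_left k.add_left)
  next
    case (seq C m)
    show ?case
    proof (cases "m = n")
      case True
      have "h (P n) (P n) ** (N n ** (A n ** k (Q n) (Q n))) = A n ** k (Q n) (Q n)"
        by (simp add: matrix_mul_assoc N)
      then show ?thesis using True
        by (simp add: left_linear_const_mult[OF T] A h.const_mult_left k.const_mult_left
            h.const_mult_right B_def flip: matrix_mul_assoc)
    next
      case False
      then show ?thesis using P Q
        by (simp add: left_linear_const_mult[OF T] A h.const_mult_left k.const_mult_left
            h.const_mult_right h.orthogonal_def k.orthogonal_def)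
    qed
  qed
  have "\<exists>g. \<forall>p. k (T p) f = h p g" for f
    using Q_seq
  proof (induction f rule: nonsingular_seq_induct)
    case zero
    then show ?case by (auto intro: exI[of _ 0])
  next
    case (add f g)
    then show ?case by (metis h.add_right k.add_right)
  next
    case (seq C n)
    then show ?case by (metis B h.const_mult_right k.const_mult_right)
  qed
  \<comment> \<open>S is chosen pointwise; its linearity and its values on Q_n follow because h
    determines a representing polynomial uniquely.\<close>
  then obtain S where S: "\<And>p f. k (T p) f = h p (S f)" by metis
  show thesis
  proof
    show "left_linear S"
      by rule (auto intro!: h.eqI simp: S[symmetric] h.add_right k.add_right
          h.const_mult_right k.const_mult_right)
    show "adjoint T S" by (simp add: adjoint_def S)
    show "S (Q n) = pm_const (B n) ** P n" for n
      by (rule h.eqI) (simp add: B flip: S)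
    show "invertible (B n)" if "invertible (A n)" for n
    proof -
      have "invertible (N n)" using N by (auto simp: invertible_def)
      then show ?thesis
        unfolding B_def using that k.invertible_gram[OF Q]
        by (intro invertible_herm invertible_mult)
    qed
  qed
qed

text \<open>The adjoint inherits the vanishing of iterated commutators with x, and this vanishing
  characterizes differential operators.\<close>

lemma dop_adjoint_exists:
  assumes P: "h.orthogonal P" and Q: "k.orthogonal Q"
    and A: "\<And>n. dop_act (P n) V = pm_const (A n) ** Q n"
  obtains U B where "\<And>n. dop_act (Q n) U = pm_const (B n) ** P n"
    "\<And>n. invertible (A n) \<Longrightarrow> invertible (B n)"
proof -
  obtain S B where S: "left_linear S" "adjoint (\<lambda>p. dop_act p V) S"
    "\<And>n. S (Q n) = pm_const (B n) ** P n"
    and B: "\<And>n. invertible (A n) \<Longrightarrow> invertible (B n)"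
    using adjoint_exists[OF P Q left_linear_dop_act A] by blast
  have "(ad_X ^^ Suc (degree V)) S = (\<lambda>_. 0)"
    by (intro adjoint_ad_X_nilpotent[OF S(2)] ad_X_dop_act_eq_0) simp
  then obtain U where "\<And>f. S f = dop_act f U"
    using ad_X_nilpotent_imp_dop[OF S(1)] by blast
  then show thesis using that[of U B] S(3) B by simp
qed

end


section \<open>Degree-preserving operators\<close>

text \<open>If C A_n = 0 with C nonzero, then C P_n has degree n, possibly with singular leading
  coefficient, but V maps it to 0.\<close>

lemma degree_preserving_imp_invertible:
  fixes P Q :: "nat \<Rightarrow> 'n::finite pmat"
  assumes "nonsingular_seq P" "degree_preserving V"
    and A: "\<And>n. dop_act (P n) V = pm_const (A n) ** Q n"
  shows "\<forall>\<^sub>\<infinity>n. invertible (A n)"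
proof -
  have "\<forall>\<^sub>\<infinity>n. \<forall>f. has_degree f n \<longrightarrow> has_degree (dop_act f V) n"
    using assms(2) by (simp add: degree_preserving_def)
  then show ?thesis
  proof (rule MOST_mono)
    fix n
    assume deg: "\<forall>f. has_degree f n \<longrightarrow> has_degree (dop_act f V) n"
    show "invertible (A n)"
    proof (rule invertible_if_left_kernel, rule ccontr)
      fix C :: "'n cmat"
      assume C: "C ** A n = 0" "C \<noteq> 0"
      have "has_degree (pm_const C ** P n) n"
        using assms(1) C(2) invertible_mult_right_cancel
        by (auto simp: has_degree_iff pm_coeff_const_mult nonsingular_seq_def
            intro: degree_less_const_mult)
      then have "has_degree (dop_act (pm_const C ** P n) V) n" using deg by blast
      also have "dop_act (pm_const C ** P n) V = pm_const (C ** A n) ** Q n"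
        by (simp add: left_linear_const_mult[OF left_linear_dop_act] A pm_const_mult
            matrix_mul_assoc)
      finally show False using C(1) by (simp add: has_degree_iff)
    qed
  qed
qed

text \<open>V never raises degrees, so coefficient n of the image of f comes from the component C
  P_n alone and equals C A_n times the invertible leading coefficient of Q_n.\<close>

lemma invertible_imp_degree_preserving:
  fixes P Q :: "nat \<Rightarrow> 'n::finite pmat"
  assumes P: "nonsingular_seq P" and Q: "nonsingular_seq Q"
    and A: "\<And>n. dop_act (P n) V = pm_const (A n) ** Q n"
    and inv: "\<forall>\<^sub>\<infinity>n. invertible (A n)"
  shows "degree_preserving V"
proof -
  note linear = left_linear_add[OF left_linear_dop_act]
    left_linear_const_mult[OF left_linear_dop_act] left_linear_0[OF left_linear_dop_act]
  \<comment> \<open>This holds for every n, also where A_n is singular.\<close>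
  have less: "degree_less (dop_act g V) n" if "degree_less g n" for g n
    using P that
  proof (rule nonsingular_seq_induct_degree)
    show "degree_less (dop_act (pm_const C ** P m) V) n" if "m < n" for C m
      using Q that
      by (auto simp: linear A nonsingular_seq_def
          intro!: degree_less_const_mult intro: degree_less_mono Suc_leI)
  qed (auto simp: linear intro: degree_less_add, simp add: degree_less_def)
  show ?thesis
    unfolding degree_preserving_def
  proof (rule MOST_mono[OF inv], intro allI impI)
    fix n and f :: "'n pmat"
    assume inv: "invertible (A n)" and f: "has_degree f n"
    obtain C g where C: "f = pm_const C ** P n + g" "degree_less g n"
      "pm_coeff f n = C ** pm_coeff (P n) n"
      using nonsingular_seq_split[OF P, of f n] f by (auto simp: has_degree_iff)
    have "C \<noteq> 0"
      using C(3) f by (auto simp: has_degree_iff)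
    have "pm_coeff (dop_act g V) n = 0"
      using less[OF C(2)] by (simp add: degree_less_def)
    then have "pm_coeff (dop_act f V) n = C ** (A n ** pm_coeff (Q n) n)"
      by (simp add: C(1) linear A pm_coeff_add pm_coeff_const_mult)
    moreover have "invertible (A n ** pm_coeff (Q n) n)"
      using inv Q by (intro invertible_mult) (auto simp: nonsingular_seq_def)
    ultimately have "pm_coeff (dop_act f V) n \<noteq> 0"
      using \<open>C \<noteq> 0\<close> invertible_mult_right_cancel by metis
    then show "has_degree (dop_act f V) n"
      using less f by (auto simp: has_degree_iff)
  qed
qed

lemma degree_preserving_mult:
  assumes "degree_preserving V" "degree_preserving U"
  shows "degree_preserving (dop_mult V U)"
  using MOST_conjI[OF assms[unfolded degree_preserving_def]]
  unfolding degree_preserving_def dop_act_mult by (rule MOST_mono) blast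


section \<open>The inner product of a weight\<close>

lemma pm_eval_const [simp]: "pm_eval (pm_const A) x = A"
  by (simp add: pm_eval_def pm_const_def vec_eq_iff)

lemma pm_eval_add: "pm_eval (P + Q) x = pm_eval P x + pm_eval Q x"
  by (simp add: pm_eval_def vec_eq_iff)

lemma pm_eval_X_mult: "pm_eval (pm_X ** P) x = x *\<^sub>R pm_eval P x"
  unfolding mat_scalar_mult
  by (simp add: pm_eval_def vec_eq_iff scaleR_conv_of_real[where 'a=complex])

lemma pm_eval_const_mult: "pm_eval (pm_const A ** P) x = A ** pm_eval P x"
  by (simp add: pm_eval_def pm_const_def matrix_matrix_mult_def vec_eq_iff poly_sum)

lemma herm_scaleR: "herm (r *\<^sub>R A) = r *\<^sub>R herm A"
  by (simp add: herm_def vec_eq_iff)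

lemma bounded_linear_herm: "bounded_linear (herm :: 'n::finite cmat \<Rightarrow> _)"
  unfolding linear_conv_bounded_linear[symmetric]
  by (intro linearI) (simp_all add: herm_add herm_scaleR)

lemma bounded_linear_matrix_mult:
  fixes A B :: "'n::finite cmat"
  shows "bounded_linear (\<lambda>M. A ** M ** B)"
  unfolding linear_conv_bounded_linear[symmetric]
  by (intro linearI)
    (simp_all add: matrix_add_ldistrib matrix_add_rdistrib matrix_scalar_ac scalar_matrix_assoc)

lemma
  assumes T: "bounded_linear T" and f: "set_integrable M S f"
  shows set_integrable_bounded_linear: "set_integrable M S (\<lambda>x. T (f x))"
    and set_integral_bounded_linear: "(LINT x:S|M. T (f x)) = T (LINT x:S|M. f x)"
proof -
  interpret T: bounded_linear T by (rule T)
  show "set_integrable M S (\<lambda>x. T (f x))"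
    using integrable_bounded_linear[OF T f[unfolded set_integrable_def]]
    by (simp add: set_integrable_def T.scaleR)
  show "(LINT x:S|M. T (f x)) = T (LINT x:S|M. f x)"
    using integral_bounded_linear[OF T f[unfolded set_integrable_def]]
    by (simp add: set_lebesgue_integral_def T.scaleR)
qed

text \<open>Induction on P and then on Q reduces the claim to the moments of W.\<close>

lemma set_integrable_weight:
  fixes W :: "real \<Rightarrow> 'n::finite cmat"
  assumes W: "\<And>m. set_integrable M S (\<lambda>x. x ^ m *\<^sub>R W x)"
  shows "set_integrable M S (\<lambda>x. pm_eval P x ** W x ** herm (pm_eval Q x))"
proof -
  \<comment> \<open>The extra power of x makes the induction work: in the case x P the new factor
    only shifts the exponent m.\<close>
  have P: "set_integrable M S (\<lambda>x. x ^ m *\<^sub>R (pm_eval P x ** W x))" for m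
  proof (induction P arbitrary: m rule: pmat_induct)
    case (const A)
    then show ?case
      using set_integrable_bounded_linear[OF bounded_linear_matrix_mult[of A "mat 1"] W[of m]]
      by (simp add: matrix_scalar_ac scalar_matrix_assoc)
  next
    case (X P)
    show ?case
      using X[of "Suc m"] by (simp add: pm_eval_X_mult scalar_matrix_assoc mult.commute)
  next
    case (add P Q)
    show ?case
      using set_integral_add(1)[OF add(1)[of m] add(2)[of m]]
      by (simp add: pm_eval_add matrix_add_rdistrib scaleR_add_right)
  qed
  have "set_integrable M S (\<lambda>x. x ^ m *\<^sub>R (pm_eval P x ** W x ** herm (pm_eval Q x)))" for m
  proof (induction Q arbitrary: m rule: pmat_induct)
    case (const A)
    then show ?case
      using set_integrable_bounded_linear[OF bounded_linear_matrix_mult[of "mat 1" "herm A"] P[of m]]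
      by (simp add: matrix_scalar_ac scalar_matrix_assoc)
  next
    case (X Q)
    show ?case
      using X[of "Suc m"]
      by (simp add: pm_eval_X_mult herm_scaleR matrix_scalar_ac scalar_matrix_assoc mult.commute)
  next
    case (add Q R)
    show ?case
      using set_integral_add(1)[OF add(1)[of m] add(2)[of m]]
      by (simp add: pm_eval_add herm_add matrix_add_ldistrib scaleR_add_right)
  qed
  from this[of 0] show ?thesis by simp
qed

section \<open>Definiteness of the inner product of a weight\<close>

lemma quadratic_form_eq:
  "(A ** M ** herm A) $ i $ i =
    (\<Sum>j\<in>UNIV. \<Sum>k\<in>UNIV. cnj ((\<chi> j. cnj (A $ i $ j)) $ j) * M $ j $ k * (\<chi> j. cnj (A $ i $ j)) $ k)"
  by (simp add: matrix_matrix_mult_def herm_def sum_distrib_right) (rule sum.swap)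

text \<open>The diagonal entry is the quadratic form of M at the conjugate of row i of A, so it is
  positive unless this row is zero.\<close>

lemma posdef_congruence_diag:
  assumes "posdef M"
  shows "0 \<le> Re ((A ** M ** herm A) $ i $ i)"
    and "Re ((A ** M ** herm A) $ i $ i) = 0 \<Longrightarrow> A $ i $ j = 0"
proof -
  let ?v = "\<chi> j. cnj (A $ i $ j)"
  have pos: "0 < Re ((A ** M ** herm A) $ i $ i)" if "?v \<noteq> 0"
    using assms that unfolding posdef_def quadratic_form_eq by blast
  have "A $ i $ k = 0" if "?v = 0" for k
    using that by (auto simp: vec_eq_iff)
  then have zero: "(A ** M ** herm A) $ i $ i = 0" if "?v = 0"
    using that by (simp add: matrix_matrix_mult_def)
  show "0 \<le> Re ((A ** M ** herm A) $ i $ i)" using pos zero by fastforce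
  show "A $ i $ j = 0" if "Re ((A ** M ** herm A) $ i $ i) = 0"
    using pos that \<open>\<And>k. ?v = 0 \<Longrightarrow> A $ i $ k = 0\<close> by fastforce
qed

text \<open>A nonzero polynomial has finitely many roots, a null set, which would make the nonempty
  open set S null as well.\<close>

lemma poly_eq_0_if_AE_open:
  fixes p :: "complex poly"
  assumes "open S" "S \<noteq> {}" and zero: "AE x in lborel. x \<in> S \<longrightarrow> poly p (of_real x) = 0"
  shows "p = 0"
proof (rule ccontr)
  assume "p \<noteq> 0"
  then have "finite (complex_of_real -` {z. poly p z = 0})"
    by (intro finite_vimageI poly_roots_finite) (auto intro: inj_onI)
  then have "AE x in lborel. x \<notin> complex_of_real -` {z. poly p z = 0}"
    by (intro AE_not_in finite_imp_null_set_lborel)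
  with zero have "AE x in lborel. x \<notin> S" by eventually_elim auto
  then have "S \<in> null_sets lborel"
    using \<open>open S\<close> by (subst AE_iff_null_sets) auto
  then have "negligible S"
    by (simp add: negligible_iff_null_sets null_sets_completionI)
  then show False using open_not_negligible assms(1,2) by blast
qed

lemma matrix_form_weight_inner:
  fixes W :: "real \<Rightarrow> 'n::finite cmat"
  assumes "a < b" and W: "weight_matrix a b W"
  shows "matrix_form (weight_inner a b W)"
proof
  let ?I = "einterval a b"
  have int: "set_integrable lborel ?I (\<lambda>x. pm_eval P x ** W x ** herm (pm_eval Q x))" for P Q
    using W by (intro set_integrable_weight) (simp add: weight_matrix_def)
  have posdef: "AE x in lborel. x \<in> ?I \<longrightarrow> posdef (W x)"
    using W by (simp add: weight_matrix_def)
  fix P Q R :: "'n pmat" and A :: "'n cmat"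
  show "weight_inner a b W (P + Q) R = weight_inner a b W P R + weight_inner a b W Q R"
    using set_integral_add(2)[OF int[of P R] int[of Q R]]
    by (simp add: weight_inner_def pm_eval_add matrix_add_rdistrib)
  show "weight_inner a b W (pm_const A ** P) Q = A ** weight_inner a b W P Q"
    using set_integral_bounded_linear[OF bounded_linear_matrix_mult[of A "mat 1"] int[of P Q]]
    by (simp add: weight_inner_def pm_eval_const_mult matrix_mul_assoc)
  show "weight_inner a b W (pm_X ** P) Q = weight_inner a b W P (pm_X ** Q)"
    by (simp add: weight_inner_def pm_eval_X_mult herm_scaleR matrix_scalar_ac scalar_matrix_assoc)
  show "weight_inner a b W Q P = herm (weight_inner a b W P Q)"
  proof -
    have "herm (weight_inner a b W P Q) =
        (LINT x:?I|lborel. herm (pm_eval P x ** W x ** herm (pm_eval Q x)))"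
      unfolding weight_inner_def
      by (rule set_integral_bounded_linear[OF bounded_linear_herm int, symmetric])
    \<comment> \<open>The weight is Hermitian only almost everywhere, so the integrands agree only
      almost everywhere.\<close>
    also have "\<dots> = weight_inner a b W Q P"
      unfolding weight_inner_def set_lebesgue_integral_def
    proof (rule integral_cong_AE)
      show "AE x in lborel.
          indicator ?I x *\<^sub>R herm (pm_eval P x ** W x ** herm (pm_eval Q x)) =
          indicator ?I x *\<^sub>R (pm_eval Q x ** W x ** herm (pm_eval P x))"
        using posdef
        by eventually_elim (auto simp: indicator_def herm_mult posdef_def matrix_mul_assoc)
    qed (use int[of Q P] set_integrable_bounded_linear[OF bounded_linear_herm int[of P Q]]
        in \<open>auto simp: set_integrable_def dest: borel_measurable_integrable\<close>)
    finally show ?thesis ..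
  qed
  show "P = 0" if zero: "weight_inner a b W P P = 0"
  proof -
    have "P $ i $ j = 0" for i j
    proof (rule poly_eq_0_if_AE_open[OF open_einterval])
      show "?I \<noteq> {}" using einterval_nonempty[OF \<open>a < b\<close>] by blast
      \<comment> \<open>A diagonal entry turns the matrix integral into the integral of a
        nonnegative real function. If it vanishes, row i of P vanishes almost everywhere on the
        interval.\<close>
      let ?f = "\<lambda>x. Re ((pm_eval P x ** W x ** herm (pm_eval P x)) $ i $ i)"
      have T: "bounded_linear (\<lambda>M :: 'n cmat. Re (M $ i $ i))"
        by (intro bounded_linear_compose[OF bounded_linear_Re] bounded_linear_vec_nth
            bounded_linear_compose[OF bounded_linear_vec_nth])
      have "(LINT x:?I|lborel. ?f x) = 0"
        using set_integral_bounded_linear[OF T int[of P P]] zero by (simp add: weight_inner_def)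
      moreover have "integrable lborel (\<lambda>x. indicator ?I x *\<^sub>R ?f x)"
        using set_integrable_bounded_linear[OF T int[of P P]] by (simp add: set_integrable_def)
      moreover have "AE x in lborel. 0 \<le> indicator ?I x *\<^sub>R ?f x"
        using posdef by eventually_elim (auto simp: indicator_def posdef_congruence_diag(1))
      ultimately have "AE x in lborel. indicator ?I x *\<^sub>R ?f x = 0"
        by (simp add: set_lebesgue_integral_def integral_nonneg_eq_0_iff_AE)
      with posdef show "AE x in lborel. x \<in> ?I \<longrightarrow> poly (P $ i $ j) (of_real x) = 0"
      proof eventually_elim
        case (elim x)
        show ?case
          using posdef_congruence_diag(2)[of "W x" "pm_eval P x" i j] elim
          by (auto simp: pm_eval_def)
      qed
    qed
    then show ?thesis by (simp add: vec_eq_iff)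
  qed
qed


section \<open>Darboux transformations\<close>

lemma orthogonal_seq_iff:
  assumes "a < b" "weight_matrix a b W"
  shows "orthogonal_seq a b W P \<longleftrightarrow> matrix_form.orthogonal (weight_inner a b W) P"
proof -
  interpret matrix_form "weight_inner a b W" by (rule matrix_form_weight_inner[OF assms])
  have "has_degree (P n) n \<longleftrightarrow> degree_less (P n) (Suc n)" if "invertible (pm_coeff (P n) n)" for n
  proof -
    have "mat 1 \<noteq> (0 :: 'a cmat)" by (simp add: mat_def vec_eq_iff)
    then have "pm_coeff (P n) n \<noteq> 0"
      using invertible_mult_right_cancel[OF that, of "mat 1"] by auto
    then show ?thesis by (simp add: has_degree_iff)
  qed
  then show ?thesis
    by (auto simp: orthogonal_seq_def orthogonal_def nonsingular_seq_def)
qed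

text \<open>One orthogonal sequence suffices: any other differs by invertible constant left factors
  C, which replace the eigenvalue A by its conjugate under C.\<close>

lemma dop_algebra_iff:
  assumes "a < b" "weight_matrix a b W" "orthogonal_seq a b W P"
  shows "D \<in> dop_algebra a b W \<longleftrightarrow> (\<forall>n. \<exists>A. dop_act (P n) D = pm_const A ** P n)"
proof
  assume "D \<in> dop_algebra a b W"
  then show "\<forall>n. \<exists>A. dop_act (P n) D = pm_const A ** P n"
    using assms(3) by (simp add: dop_algebra_def)
next
  interpret matrix_form "weight_inner a b W" by (rule matrix_form_weight_inner[OF assms(1,2)])
  assume D: "\<forall>n. \<exists>A. dop_act (P n) D = pm_const A ** P n"
  have "\<exists>B. dop_act (P' n) D = pm_const B ** P' n" if P': "orthogonal_seq a b W P'" for P' n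
  proof -
    obtain C where C: "invertible C" "P' n = pm_const C ** P n"
      using orthogonal_unique[of P P' n] P' assms(3) orthogonal_seq_iff[OF assms(1,2)] by metis
    obtain N where "N ** C = mat 1" using C(1) by (auto simp: invertible_def)
    then have P: "P n = pm_const N ** P' n"
      unfolding C(2) matrix_mul_assoc pm_const_mult[symmetric] by simp
    obtain A where "dop_act (P n) D = pm_const A ** P n" using D by blast
    then have "dop_act (P' n) D = pm_const C ** (pm_const A ** P n)"
      by (simp add: C(2) left_linear_const_mult[OF left_linear_dop_act])
    also have "\<dots> = pm_const (C ** A ** N) ** P' n"
      by (subst P) (simp add: pm_const_mult matrix_mul_assoc)
    finally show ?thesis by blast
  qed
  then show "D \<in> dop_algebra a b W" by (simp add: dop_algebra_def)
qed

section \<open>Intertwining operators between two sequences\<close>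

definition intertwines :: "(nat \<Rightarrow> 'n::finite pmat) \<Rightarrow> 'n dop \<Rightarrow> (nat \<Rightarrow> 'n pmat) \<Rightarrow> bool"
  where "intertwines P V Q \<longleftrightarrow> (\<forall>n. \<exists>A. dop_act (P n) V = pm_const A ** Q n)"

lemma intertwines_mult:
  assumes "intertwines P V Q" "intertwines Q U R"
  shows "intertwines P (dop_mult V U) R"
  unfolding intertwines_def
proof
  fix n
  obtain A B where "dop_act (P n) V = pm_const A ** Q n" "dop_act (Q n) U = pm_const B ** R n"
    using assms unfolding intertwines_def by meson
  then have "dop_act (P n) (dop_mult V U) = pm_const (A ** B) ** R n"
    by (simp add: dop_act_mult left_linear_const_mult[OF left_linear_dop_act] pm_const_mult
        matrix_mul_assoc)
  then show "\<exists>A. dop_act (P n) (dop_mult V U) = pm_const A ** R n" ..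
qed

lemma intertwines_id: "intertwines P (monom (mat 1) 0) P"
  unfolding intertwines_def dop_act_monom by (auto intro: exI[of _ "mat 1"])

lemma degree_preserving_id: "degree_preserving (monom (mat 1) 0)"
  by (simp add: degree_preserving_def dop_act_monom)

text \<open>The adjoint of V runs backwards, and its factors B_n are invertible wherever the A_n
  are, that is, for almost all n; this makes it degree-preserving.\<close>

lemma intertwines_adjoint:
  fixes P Q :: "nat \<Rightarrow> 'n::finite pmat"
  assumes "a < b" and W: "weight_matrix a b W" "orthogonal_seq a b W P"
    and W': "weight_matrix a b W'" "orthogonal_seq a b W' Q"
    and V: "degree_preserving V" "intertwines P V Q"
  obtains U where "degree_preserving U" "intertwines Q U P"
proof -
  interpret matrix_form_pair "weight_inner a b W" "weight_inner a b W'"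
    using assms by (simp add: matrix_form_pair_def matrix_form_weight_inner)
  have PQ: "h.orthogonal P" "k.orthogonal Q"
    using assms orthogonal_seq_iff by blast+
  then have seq: "nonsingular_seq P" "nonsingular_seq Q"
    by (simp_all add: h.orthogonal_def k.orthogonal_def)
  obtain A where A: "\<And>n. dop_act (P n) V = pm_const (A n) ** Q n"
    using V(2) unfolding intertwines_def by metis
  obtain U B where U: "\<And>n. dop_act (Q n) U = pm_const (B n) ** P n"
    and B: "\<And>n. invertible (A n) \<Longrightarrow> invertible (B n)"
    using dop_adjoint_exists[OF PQ A] by blast
  have "\<forall>\<^sub>\<infinity>n. invertible (B n)"
    using degree_preserving_imp_invertible[OF seq(1) V(1) A] B by (rule MOST_mono)
  then have "degree_preserving U"
    by (rule invertible_imp_degree_preserving[OF seq(2,1) U])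
  then show thesis using that U unfolding intertwines_def by blast
qed

text \<open>Any degree-preserving V with P_n V = A_n Q_n can be completed to a factorization: with
  its adjoint U, the operator V U maps P_n to A_n B_n P_n.\<close>

lemma darboux_iff:
  assumes "a < b" and W: "weight_matrix a b W" "orthogonal_seq a b W P"
    and W': "weight_matrix a b W'" "orthogonal_seq a b W' Q"
  shows "darboux a b W P Q \<longleftrightarrow> (\<exists>V. degree_preserving V \<and> intertwines P V Q)"
proof
  assume "darboux a b W P Q"
  then show "\<exists>V. degree_preserving V \<and> intertwines P V Q"
    unfolding darboux_def intertwines_def by blast
next
  assume "\<exists>V. degree_preserving V \<and> intertwines P V Q"
  then obtain V where V: "degree_preserving V" "intertwines P V Q" by blast
  obtain U where U: "degree_preserving U" "intertwines Q U P"
    using intertwines_adjoint[OF assms V] .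
  have "dop_mult V U \<in> dop_algebra a b W"
    using intertwines_mult[OF V(2) U(2)] dop_algebra_iff[OF assms(1) W]
    by (simp add: intertwines_def)
  then show "darboux a b W P Q"
    using U(1) V unfolding darboux_def intertwines_def by blast
qed

theorem mainTheorem8:
  fixes x0 x1 :: ereal and \<W> :: "(real \<Rightarrow> complex^'n::finite^'n) set"
  assumes "x0 < x1"
    and "good_weights x0 x1 \<W>"
  shows "equiv (orthogonal_seqs x0 x1 \<W>) (darboux_rel x0 x1 \<W>)"
proof -
  have weight: "weight_matrix x0 x1 W" if "W \<in> \<W>" for W
    using assms(2) that by (simp add: good_weights_def)
  \<comment> \<open>In this form reflexivity comes from the identity operator, symmetry from
    adjoints and transitivity from products.\<close>
  have rel: "(P, Q) \<in> darboux_rel x0 x1 \<W> \<longleftrightarrow>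
      P \<in> orthogonal_seqs x0 x1 \<W> \<and> Q \<in> orthogonal_seqs x0 x1 \<W> \<and>
      (\<exists>V. degree_preserving V \<and> intertwines P V Q)" for P Q
    using darboux_iff[OF assms(1)] weight unfolding darboux_rel_def orthogonal_seqs_def by blast
  show ?thesis
  proof (rule equivI)
    show "darboux_rel x0 x1 \<W> \<subseteq> orthogonal_seqs x0 x1 \<W> \<times> orthogonal_seqs x0 x1 \<W>"
      by (auto simp: rel)
    show "refl_on (orthogonal_seqs x0 x1 \<W>) (darboux_rel x0 x1 \<W>)"
      using intertwines_id degree_preserving_id by (auto simp: refl_on_def rel)
    show "sym (darboux_rel x0 x1 \<W>)"
    proof (rule symI)
      fix P Q
      assume "(P, Q) \<in> darboux_rel x0 x1 \<W>"
      then show "(Q, P) \<in> darboux_rel x0 x1 \<W>"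
        unfolding rel orthogonal_seqs_def
        using intertwines_adjoint[OF assms(1)] weight by blast
    qed
    show "trans (darboux_rel x0 x1 \<W>)"
      using intertwines_mult degree_preserving_mult by (intro transI) (simp add: rel, blast)
  qed
qed

end
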